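(* Let $N$ be a near-ring with $1 \neq 0$, let $\leq$ be a total ordering on $N$, and let $(N,<)$ be an ordered near-ring. Then the following statements are equivalent: (1) The near-ring $N$ is dense, i.e. the positive cone $P=\{x\in N: 0<x\}$ of $N$ has no least element. (2) There is a positive element $\alpha$ in $N$ with $\alpha<1$. (3) The ordered monoid $(N,+,0,\leq)$ is a dense monoid. (4) For any positive element $\epsilon$ in $N$ and any positive integer $n$, there are $n$ positive elements $\epsilon_1,\dots,\epsilon_n$ in $N$ such that $\sum_{i=1}^{n}\epsilon_i<\epsilon$. (5) The ordered set $N$ is dense, i.e. for all $r<t$ in $N$ there is an $s$ in $N$ with $r<s<t$.
   Context: A near-ring $(N,+,\cdot,0)$ is an algebraic structure such that $(N,+)$ is a (not necessarily abelian) group with identity element $0$, $(N,\cdot)$ is a semigroup, and the right-distributive law $(x+y)z=xz+yz$ holds for all $x,y,z\in N$. It is a near-ring with $1$ if $(N,\cdot,1)$ is a monoid. $(N,\leq)$ is an ordered near-ring if $\leq$ is a partial ordering on $N$ such that $(N,+,0,\leq)$ is an ordered group (i.e. $a\leq b$ implies $a+c\leq b+c$ and $c+a\leq c+b$) and $0\leq x$, $0\leq y$ imply $0\leq xy$. One says that $(N,<)$ is an ordered near-ring if $(N,\leq)$ is an ordered near-ring and moreover $0<x$ and $0<y$ imply $0<xy$. Here $a<b$ means $a\leq b$ and $a\neq b$, and $x$ is positive if $0<x$. An ordered monoid $(M,+,0,\leq)$ (not necessarily commutative; $\leq$ is a partial ordering compatible with $+$ on both sides) is a dense monoid if for every positive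 $\epsilon\in M$ there are positive $\beta,\gamma\in M$ with $\beta+\gamma<\epsilon$. *)

theory Defs
  imports Main
begin

class near_ring = group_add + semigroup_mult +
  assumes near_distrib_right: "(x + y) * z = x * z + y * z"

text \<open>The law \<open>1 \<noteq> 0\<close> is not part of the class.\<close>

class near_ring_1 = near_ring + monoid_mult

text \<open>
  Addition is not assumed to be commutative, so the library's hierarchy of ordered
  (abelian) monoids and groups does not apply.
\<close>

class ordered_noncomm_monoid_add = monoid_add + order +
  assumes add_right_compat: "a \<le> b \<Longrightarrow> a + c \<le> b + c"
    and add_left_compat: "a \<le> b \<Longrightarrow> c + a \<le> c + b"

class ordered_near_ring = near_ring + ordered_noncomm_monoid_add +
  assumes near_mult_nonneg: "0 \<le> x \<Longrightarrow> 0 \<le> y \<Longrightarrow> 0 \<le> x * y"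

text \<open>This is the condition that \<open>(N, <)\<close>, and not only \<open>(N, \<le>)\<close>, is an ordered near-ring.\<close>

class strict_ordered_near_ring = ordered_near_ring +
  assumes near_mult_pos: "0 < x \<Longrightarrow> 0 < y \<Longrightarrow> 0 < x * y"

definition positive_cone :: "'a::ordered_near_ring set" where
  "positive_cone = {x. 0 < x}"

definition dense_near_ring :: "'a::ordered_near_ring itself \<Rightarrow> bool" where
  "dense_near_ring _ \<longleftrightarrow>
    \<not> (\<exists>m \<in> (positive_cone :: 'a set). \<forall>x \<in> positive_cone. m \<le> x)"

definition dense_monoid :: "'a::ordered_noncomm_monoid_add itself \<Rightarrow> bool" where
  "dense_monoid _ \<longleftrightarrow>
    (\<forall>\<epsilon>::'a. 0 < \<epsilon> \<longrightarrow> (\<exists>\<beta> \<gamma>. 0 < \<beta> \<and> 0 < \<gamma> \<and> \<beta> + \<gamma> < \<epsilon>))"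

end

theory Submission
  imports Defs
begin

text \<open>
  If \<open>0 < \<alpha> < 1\<close>, then right distributivity turns \<open>1 - \<alpha> > 0\<close> into \<open>m - \<alpha> * m > 0\<close> for
  every positive \<open>m\<close>, so \<open>m\<close> is not least; conversely \<open>1\<close> is positive, since otherwise
  \<open>1 = (- 1) * (- 1)\<close> would be positive too. The other equivalences hold in every totally
  ordered group: given \<open>0 < \<delta> < \<epsilon>\<close>, write \<open>\<epsilon> = \<delta> + \<eta>\<close>; any positive \<open>\<nu>\<close> strictly below
  both \<open>\<delta>\<close> and \<open>\<eta>\<close> satisfies \<open>\<nu> + \<nu> < \<epsilon>\<close>.
\<close>

lemma add_strict_left_mono_noncomm:
  fixes a b c :: "'a::{group_add, ordered_noncomm_monoid_add}"
  assumes "a < b"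
  shows "c + a < c + b"
  using assms add_left_compat[of a b c] by (simp add: order.strict_iff_order)

lemma add_strict_right_mono_noncomm:
  fixes a b c :: "'a::{group_add, ordered_noncomm_monoid_add}"
  assumes "a < b"
  shows "a + c < b + c"
  using assms add_right_compat[of a b c] by (simp add: order.strict_iff_order)

lemma neg_pos_iff_noncomm:
  fixes a :: "'a::{group_add, ordered_noncomm_monoid_add}"
  shows "0 < - a \<longleftrightarrow> a < 0"
  using add_strict_left_mono_noncomm[of 0 "- a" a] add_strict_left_mono_noncomm[of a 0 "- a"]
  by auto

lemma minus_pos_iff_noncomm:
  fixes a b :: "'a::{group_add, ordered_noncomm_monoid_add}"
  shows "0 < b - a \<longleftrightarrow> a < b"
  using add_strict_right_mono_noncomm[of 0 "b - a" a] add_strict_right_mono_noncomm[of a b "- a"]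
  by auto

lemma uminus_add_pos_iff_noncomm:
  fixes a b :: "'a::{group_add, ordered_noncomm_monoid_add}"
  shows "0 < - a + b \<longleftrightarrow> a < b"
  using add_strict_left_mono_noncomm[of 0 "- a + b" a] add_strict_left_mono_noncomm[of a b "- a"]
  by (auto simp: add.assoc[symmetric])

text \<open>Right distributivity makes only \<open>x \<mapsto> x * z\<close> additive, so zero,
  signs and differences can be moved out of the left factor; \<open>z * 0 = 0\<close> may fail in a
  near-ring.\<close>

lemma near_mult_zero_left: "0 * z = (0::'a::near_ring)"
  using near_distrib_right[of 0 0 z] by (metis add.right_neutral add_left_imp_eq)

lemma near_mult_minus_left: "(- x) * z = - (x * (z::'a::near_ring))"
  using near_distrib_right[of "- x" x z]
  by (simp add: near_mult_zero_left eq_neg_iff_add_eq_0)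

lemma near_left_diff_distrib: "(x - y) * z = x * z - y * (z::'a::near_ring)"
  using near_distrib_right[of x "- y" z] by (simp add: near_mult_minus_left)

lemma near_one_pos:
  assumes "(1::'a::{near_ring_1, strict_ordered_near_ring, linorder}) \<noteq> 0"
  shows "0 < (1::'a)"
proof (rule ccontr)
  assume "\<not> 0 < (1::'a)"
  then have neg: "(1::'a) < 0"
    using assms by simp
  then have "0 < (- 1) * (- 1::'a)"
    by (simp add: near_mult_pos neg_pos_iff_noncomm)
  \<comment> \<open>The sign of the left factor comes out, leaving \<open>- (1 * (- 1))\<close>; the
    right factor is then settled by \<open>1\<close> being a left identity.\<close>
  with neg show False
    by (simp add: near_mult_minus_left)
qed

lemma near_mult_less_self:
  fixes \<alpha> m :: "'a::{near_ring_1, strict_ordered_near_ring}"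
  assumes "\<alpha> < 1" "0 < m"
  shows "\<alpha> * m < m"
proof -
  have "0 < (1 - \<alpha>) * m"
    using assms by (simp add: near_mult_pos minus_pos_iff_noncomm)
  then show ?thesis
    by (simp add: near_left_diff_distrib minus_pos_iff_noncomm)
qed

text \<open>Totality turns "not below every positive element" into "some positive element is
  strictly smaller". This form is the hub through which the other conditions are compared.\<close>

lemma dense_near_ring_iff:
  "dense_near_ring TYPE('a::{ordered_near_ring, linorder}) \<longleftrightarrow>
    (\<forall>\<epsilon>::'a. 0 < \<epsilon> \<longrightarrow> (\<exists>\<delta>. 0 < \<delta> \<and> \<delta> < \<epsilon>))"
  by (auto simp: dense_near_ring_def positive_cone_def not_le)

text \<open>Forwards, take \<epsilon> to be \<open>1\<close>, which is positive; backwards,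
  \<open>\<alpha> * \<epsilon>\<close> is a positive element below \<epsilon>.\<close>

lemma dense_near_ring_iff_pos_less_one:
  assumes "(1::'a::{near_ring_1, strict_ordered_near_ring, linorder}) \<noteq> 0"
  shows "dense_near_ring TYPE('a) \<longleftrightarrow> (\<exists>\<alpha>::'a. 0 < \<alpha> \<and> \<alpha> < 1)"
  unfolding dense_near_ring_iff
  using near_one_pos[OF assms] near_mult_less_self near_mult_pos by blast

lemma dense_monoid_iff:
  "dense_monoid TYPE('a::{group_add, ordered_noncomm_monoid_add, linorder}) \<longleftrightarrow>
    (\<forall>\<epsilon>::'a. 0 < \<epsilon> \<longrightarrow> (\<exists>\<delta>. 0 < \<delta> \<and> \<delta> < \<epsilon>))"
proof
  assume dense: "dense_monoid TYPE('a)"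
  show "\<forall>\<epsilon>::'a. 0 < \<epsilon> \<longrightarrow> (\<exists>\<delta>. 0 < \<delta> \<and> \<delta> < \<epsilon>)"
  proof (intro allI impI)
    fix \<epsilon> :: 'a assume "0 < \<epsilon>"
    then obtain \<beta> \<gamma> :: 'a where "0 < \<beta>" "0 < \<gamma>" "\<beta> + \<gamma> < \<epsilon>"
      using dense unfolding dense_monoid_def by blast
    moreover from \<open>0 < \<gamma>\<close> have "\<beta> < \<beta> + \<gamma>"
      using add_strict_left_mono_noncomm[of 0 \<gamma> \<beta>] by simp
    ultimately show "\<exists>\<delta>. 0 < \<delta> \<and> \<delta> < \<epsilon>"
      by (blast intro: less_trans)
  qed
next
  assume dense: "\<forall>\<epsilon>::'a. 0 < \<epsilon> \<longrightarrow> (\<exists>\<delta>. 0 < \<delta> \<and> \<delta> < \<epsilon>)"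
  show "dense_monoid TYPE('a)"
    unfolding dense_monoid_def
  proof (intro allI impI)
    fix \<epsilon> :: 'a assume "0 < \<epsilon>"
    then obtain \<delta> where "0 < \<delta>" "\<delta> < \<epsilon>"
      using dense by blast
    \<comment> \<open>The remainder is subtracted on the left, so that adding \<delta> on the left
      gives back \<epsilon> without commutativity. Applying density to the minimum bounds \<nu> by
      both parts at once.\<close>
    then have "0 < min \<delta> (- \<delta> + \<epsilon>)"
      by (simp add: uminus_add_pos_iff_noncomm)
    then obtain \<nu> where \<nu>: "0 < \<nu>" "\<nu> < \<delta>" "\<nu> < - \<delta> + \<epsilon>"
      using dense by (metis min_less_iff_conj)
    have "\<nu> + \<nu> < \<delta> + \<nu>"
      using \<nu> by (simp add: add_strict_right_mono_noncomm)
    also have "\<dots> < \<delta> + (- \<delta> + \<epsilon>)"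
      using \<nu>(3) by (rule add_strict_left_mono_noncomm)
    also have "\<dots> = \<epsilon>"
      by (simp add: add.assoc[symmetric])
    finally show "\<exists>\<beta> \<gamma>. 0 < \<beta> \<and> 0 < \<gamma> \<and> \<beta> + \<gamma> < \<epsilon>"
      using \<nu>(1) by blast
  qed
qed

text \<open>Split off \<beta> with \<open>\<beta> + \<gamma> < \<epsilon>\<close> and fit the other
  summands below \<gamma>; hence the induction varies \<epsilon>. It starts from the empty sum
  \<open>0\<close>.\<close>

lemma dense_monoid_imp_sum_list_less:
  fixes \<epsilon> :: "'a::{group_add, ordered_noncomm_monoid_add}"
  assumes "dense_monoid TYPE('a)" "0 < \<epsilon>"
  shows "\<exists>es::'a list. length es = n \<and> (\<forall>e \<in> set es. 0 < e) \<and> sum_list es < \<epsilon>"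
  using assms(2)
proof (induction n arbitrary: \<epsilon>)
  case 0
  then show ?case by simp
next
  case (Suc n)
  then obtain \<beta> \<gamma> :: 'a where "0 < \<beta>" "0 < \<gamma>" "\<beta> + \<gamma> < \<epsilon>"
    using assms(1) unfolding dense_monoid_def by blast
  moreover from Suc.IH[OF \<open>0 < \<gamma>\<close>] obtain es :: "'a list"
    where "length es = n" "\<forall>e \<in> set es. 0 < e" "sum_list es < \<gamma>"
    by blast
  moreover from \<open>sum_list es < \<gamma>\<close> have "\<beta> + sum_list es < \<beta> + \<gamma>"
    by (rule add_strict_left_mono_noncomm)
  ultimately have "length (\<beta> # es) = Suc n \<and> (\<forall>e \<in> set (\<beta> # es). 0 < e) \<and> sum_list (\<beta> # es) < \<epsilon>"
    by auto
  then show ?case ..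
qed

lemma dense_monoid_iff_sum_list:
  "dense_monoid TYPE('a::{group_add, ordered_noncomm_monoid_add, linorder}) \<longleftrightarrow>
    (\<forall>(\<epsilon>::'a) (n::nat). 0 < \<epsilon> \<longrightarrow> 0 < n \<longrightarrow>
      (\<exists>es::'a list. length es = n \<and> (\<forall>e \<in> set es. 0 < e) \<and> sum_list es < \<epsilon>))"
  (is "_ \<longleftrightarrow> ?sums")
proof
  assume "dense_monoid TYPE('a)"
  then show ?sums
    using dense_monoid_imp_sum_list_less by blast
next
  assume sums: ?sums
  show "dense_monoid TYPE('a)"
    unfolding dense_monoid_iff
  proof (intro allI impI)
    fix \<epsilon> :: 'a assume "0 < \<epsilon>"
    \<comment> \<open>The case \<open>n = 1\<close> is enough: the single summand is itself a
      positive element below \<epsilon>.\<close>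
    then obtain es :: "'a list" where
      es: "length es = 1" "\<forall>e \<in> set es. 0 < e" "sum_list es < \<epsilon>"
      using sums by (meson zero_less_one)
    then obtain \<delta> where "es = [\<delta>]"
      by (auto simp: length_Suc_conv)
    with es show "\<exists>\<delta>. 0 < \<delta> \<and> \<delta> < \<epsilon>"
      by auto
  qed
qed

text \<open>Left translation by \<open>r\<close> carries the interval from \<open>0\<close> to
  \<open>- r + t\<close> onto the interval from \<open>r\<close> to \<open>t\<close>. The converse
  is the case \<open>r = 0\<close>.\<close>

lemma dense_order_iff:
  "(\<forall>(r::'a::{group_add, ordered_noncomm_monoid_add}) t. r < t \<longrightarrow> (\<exists>s. r < s \<and> s < t)) \<longleftrightarrow>
    (\<forall>\<epsilon>::'a. 0 < \<epsilon> \<longrightarrow> (\<exists>\<delta>. 0 < \<delta> \<and> \<delta> < \<epsilon>))"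
proof (intro iffI allI impI)
  fix r t :: 'a
  assume dense: "\<forall>\<epsilon>::'a. 0 < \<epsilon> \<longrightarrow> (\<exists>\<delta>. 0 < \<delta> \<and> \<delta> < \<epsilon>)" and "r < t"
  then obtain \<delta> where "0 < \<delta>" "\<delta> < - r + t"
    using uminus_add_pos_iff_noncomm by blast
  then have "r < r + \<delta> \<and> r + \<delta> < t"
    using add_strict_left_mono_noncomm[of 0 \<delta> r] add_strict_left_mono_noncomm[of \<delta> "- r + t" r]
    by (simp add: add.assoc[symmetric])
  then show "\<exists>s. r < s \<and> s < t" ..
qed blast

theorem theorem2p8:
  assumes "(1 :: 'a :: {near_ring_1, strict_ordered_near_ring, linorder}) \<noteq> 0"
  shows
    "(dense_near_ring TYPE('a) \<longleftrightarrow> (\<exists>\<alpha>::'a. 0 < \<alpha> \<and> \<alpha> < 1)) \<and>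
     (dense_near_ring TYPE('a) \<longleftrightarrow> dense_monoid TYPE('a)) \<and>
     (dense_near_ring TYPE('a) \<longleftrightarrow>
        (\<forall>(\<epsilon>::'a) (n::nat). 0 < \<epsilon> \<longrightarrow> 0 < n \<longrightarrow>
           (\<exists>es::'a list. length es = n \<and> (\<forall>e \<in> set es. 0 < e) \<and> sum_list es < \<epsilon>))) \<and>
     (dense_near_ring TYPE('a) \<longleftrightarrow>
        (\<forall>(r::'a) t. r < t \<longrightarrow> (\<exists>s. r < s \<and> s < t)))"
  using dense_near_ring_iff_pos_less_one[OF assms] dense_monoid_iff_sum_list[where 'a = 'a]
  unfolding dense_near_ring_iff dense_monoid_iff dense_order_iff by blast

end
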